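(* Let $A\subseteq\mathbb{R}$ be a finite convex set. Then \[ |A+A|\geq |A|^{30/19-o(1)}\,. \]
   Context: A finite set $A=\{a_1<a_2<\dots<a_n\}\subseteq\mathbb{R}$ is called convex if the sequence of consecutive differences $a_{i+1}-a_i$, $i=1,\dots,n-1$, is strictly increasing. $A+A=\{a+b:a,b\in A\}$. The term $o(1)$ denotes a quantity tending to $0$ as $|A|\to\infty$ (uniformly over all such sets). *)

theory Defs
  imports Complex_Main "HOL-Library.Set_Algebras"
begin

(* Convexity of the increasing enumeration of a finite set; this is unrelated to
   convexity of subsets of a vector space (constant convex of HOL-Analysis). *)
definition convex_finset :: "real set \<Rightarrow> bool" where
  "convex_finset A \<longleftrightarrow> finite A \<and>
     (let a = (!) (sorted_list_of_set A)
      in strict_mono_on {..<card A - 1} (\<lambda>i. a (Suc i) - a i))"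

end

theory Submission
  imports Defs "HOL-Analysis.Convex" "HOL-Analysis.Harmonic_Numbers" "HOL-Real_Asymp.Real_Asymp"
begin

text \<open>
  Write \<open>n = |A|\<close>, \<open>s = |A + A|\<close>, and ignore logarithms. For convex \<open>A\<close> and arbitrary \<open>B\<close>, at most
  \<open>O(n |B|\<^sup>2 / t\<^sup>3)\<close> numbers have \<open>t\<close> representations as \<open>a - b\<close>: cutting both sets into about \<open>t / 4\<close>
  blocks, most representations of such a number share a pair of blocks with another one, and
  convexity recovers the position in \<open>A\<close> from the two elements of \<open>B\<close> and the index gap in \<open>A\<close>.
  Hence the third moment of the representation function is at most \<open>n |B|\<^sup>2\<close>.

  Pass to a subset \<open>A'\<close> of proportional size such that any \<open>b, c \<in> A'\<close> have at least \<open>n / 2\<close> common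
  \<open>a \<in> A\<close> for which \<open>a + b\<close> and \<open>a + c\<close> both have \<open>n\<^sup>2 / (8 s)\<close> representations as sums. Let \<open>P\<close> be the
  set of the \<open>p\<close> differences having at least \<open>t\<close> representations in \<open>A' - A'\<close>. Counting the triples
  \<open>(a, b, c)\<close> with \<open>b - c \<in> P\<close> via \<open>(a + b, a + c)\<close>, Cauchy-Schwarz gives \<open>(p t n)\<^sup>2 \<le> N n\<^sup>3\<close>, where \<open>N\<close>
  is the number of pairs of popular sums with difference in \<open>P\<close>. By popularity \<open>N n\<^sup>2 / s\<close> is at most the
  number of solutions of \<open>a - d = y - b\<close> with \<open>a, b \<in> A\<close>, \<open>d \<in> P\<close>, \<open>y \<in> A + A\<close>, which by Hoelder's
  inequality and the third moments is at most \<open>n p\<^bsup>5/6\<^esup> s\<^bsup>2/3\<^esup>\<close>. Together \<open>p\<^sup>7 t\<^bsup>12\<^esup> \<le> s\<^bsup>10\<^esup>\<close>, and with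
  \<open>p t\<^sup>3 \<le> n\<^sup>3\<close> this yields \<open>(p t\<^sup>2)\<^sup>9 \<le> s\<^bsup>10\<^esup> n\<^sup>6\<close> at every level \<open>t\<close>. Summing over \<open>t\<close> bounds the additive
  energy of \<open>A'\<close>, which is at least of order \<open>n\<^sup>4 / s\<close>; the result is \<open>n\<^bsup>30\<^esup> \<le> s\<^bsup>19\<^esup>\<close>.
\<close>

section \<open>Representation counts of differences\<close>

text \<open>These are the representations \<open>x = a - b\<close> with \<open>a\<close> in
  \<open>A\<close> and \<open>b\<close> in \<open>B\<close>, counted by \<open>b\<close> alone
  because \<open>b\<close> determines \<open>a\<close>.\<close>

definition rep :: "real set \<Rightarrow> real set \<Rightarrow> real \<Rightarrow> nat" where
  "rep A B x = card {b \<in> B. b + x \<in> A}"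

lemma rep_le_left:
  assumes "finite A" shows "rep A B x \<le> card A"
  unfolding rep_def
  by (rule card_inj_on_le[where f = "\<lambda>b. b + x"]) (use assms in \<open>auto simp: inj_on_def\<close>)

lemma rep_le_right:
  assumes "finite B" shows "rep A B x \<le> card B"
  unfolding rep_def by (rule card_mono) (use assms in auto)

lemma sum_rep_le:
  assumes "finite A" "finite B" "finite D"
  shows "(\<Sum>x\<in>D. rep A B x) \<le> card A * card B"
proof -
  have "(\<Sum>x\<in>D. rep A B x) = card (SIGMA x:D. {b \<in> B. b + x \<in> A})"
    unfolding rep_def using assms by (subst card_SigmaI) auto
  also have "\<dots> \<le> card (A \<times> B)"
    by (rule card_inj_on_le[where f = "\<lambda>(x, b). (b + x, b)"])
       (use assms in \<open>auto simp: inj_on_def\<close>)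
  finally show ?thesis by (simp add: card_cartesian_product)
qed

lemma finite_rep_support:
  assumes "finite A" "finite B" "t \<ge> 1"
  shows "finite {x. t \<le> rep A B x}"
proof (rule finite_subset)
  show "{x. t \<le> rep A B x} \<subseteq> (\<lambda>(a, b). a - b) ` (A \<times> B)"
  proof
    fix x assume "x \<in> {x. t \<le> rep A B x}"
    then have "rep A B x \<noteq> 0" using assms by auto
    then have "{b \<in> B. b + x \<in> A} \<noteq> {}" unfolding rep_def by (metis card.empty)
    then obtain b where "b \<in> B" "b + x \<in> A" by auto
    then show "x \<in> (\<lambda>(a, b). a - b) ` (A \<times> B)"
      by (intro image_eqI[where x = "(b + x, b)"]) auto
  qed
qed (use assms in auto)

section \<open>Convex sets: few differences have many representations\<close>

text \<open>Both sides are sums of \<open>d\<close> consecutive differences, compared term by term.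
  Consequently an index gap \<open>d\<close> together with the value of the gap determines its
  position; this is the form in which convexity enters the counting.\<close>

lemma convex_finset_gap_less:
  assumes "convex_finset A" and u: "u = (!) (sorted_list_of_set A)"
    and "i < j" "j + d < card A" "d \<ge> 1"
  shows "u (i + d) - u i < u (j + d) - u j"
  using assms(4,5)
proof (induction d)
  case (Suc d)
  have sm: "strict_mono_on {..<card A - 1} (\<lambda>i. u (Suc i) - u i)"
    using assms(1) unfolding convex_finset_def u by (simp add: Let_def)
  have step: "u (Suc (i + d)) - u (i + d) < u (Suc (j + d)) - u (j + d)"
    by (rule strict_mono_onD[OF sm]) (use Suc assms(3) in auto)
  show ?case
  proof (cases "d = 0")
    case False
    then have "u (i + d) - u i < u (j + d) - u j" using Suc by auto
    then show ?thesis using step by simp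
  qed (use step in simp)
qed simp

lemma sorted_list_of_set_nth_less_iff:
  assumes "finite A" "i < card A" "j < card A"
  shows "sorted_list_of_set A ! i < sorted_list_of_set A ! j \<longleftrightarrow> i < (j::nat)"
proof -
  have s: "sorted_wrt (<) (sorted_list_of_set A)" by simp
  have l: "length (sorted_list_of_set A) = card A" by simp
  show ?thesis
    using sorted_wrt_nth_less[OF s, of i j] sorted_wrt_nth_less[OF s, of j i] l assms
    by (cases i j rule: linorder_cases) auto
qed

text \<open>An element outside the collision set has the least first coordinate in its fibre of
  \<open>f\<close>, so by injectivity of \<open>fst\<close> there is at most one such element for
  each value.\<close>

lemma card_collisions_ge:
  fixes f :: "nat \<times> nat \<Rightarrow> 'a"
  assumes "finite I" "inj_on fst I"
  shows "card I \<le> card {p \<in> I. \<exists>q\<in>I. fst q < fst p \<and> f q = f p} + card (f ` I)"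
proof -
  let ?N = "{p \<in> I. \<exists>q\<in>I. fst q < fst p \<and> f q = f p}"
  have "inj_on f (I - ?N)"
  proof (rule inj_onI)
    fix p q assume "p \<in> I - ?N" "q \<in> I - ?N" "f p = f q"
    then have "\<not> fst q < fst p" "\<not> fst p < fst q" "p \<in> I" "q \<in> I" by (auto dest: sym)
    then show "p = q" using assms(2) by (meson inj_onD linorder_neqE_nat)
  qed
  then have "card (I - ?N) = card (f ` (I - ?N))" by (simp add: card_image)
  also have "\<dots> \<le> card (f ` I)" by (rule card_mono) (use assms in auto)
  finally have "card (I - ?N) \<le> card (f ` I)" .
  moreover have "card I = card ?N + card (I - ?N)"
    using assms(1) by (subst card_Un_disjoint[symmetric]) (auto intro: arg_cong[where f = card])
  ultimately show ?thesis by simp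
qed

text \<open>Blocks of length \<open>4 * n div t + 1\<close> are longer than 4n/t, so every block
  index of a position below \<open>n\<close> is less than t/4.\<close>

lemma four_mult_div_less:
  fixes n t :: nat assumes "t \<ge> 1"
  shows "4 * (n div (4 * n div t + 1)) < t"
proof -
  define K where "K = 4 * n div t + 1"
  have "4 * n < K * t" unfolding K_def using assms
    by (metis Suc_eq_plus1 dividend_less_div_times mult_Suc add.commute less_le_trans zero_less_one)
  moreover have "n div K * K \<le> n" by simp
  ultimately have "4 * (n div K) * K < t * K" by (metis le_less_trans mult.assoc mult.commute mult_le_mono2)
  then show ?thesis unfolding K_def[symmetric] by simp
qed

lemma same_block_diff_less:
  fixes i j K :: nat
  assumes "j \<le> i" "i div K = j div K" "K > 0"
  shows "i - j < K"
proof -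
  have "i = j div K * K + i mod K" "j = j div K * K + j mod K"
    using assms(2) by (metis div_mod_decomp)+
  moreover have "i mod K < K" using assms(3) by simp
  ultimately show ?thesis by linarith
qed

text \<open>Collisions within a pair of blocks are encoded injectively in a box of size
  \<open>m * L * K\<close>. The constant 100 is 4 * 5 * 5: at least a quarter of \<open>t\<close>
  collisions occur for each difference, and the block lengths are at most 5n/t and 5m/t.\<close>

lemma card_popular_differences:
  assumes cA: "convex_finset A" and "finite B" "t \<ge> 1"
  shows "card {x. t \<le> rep A B x} * t ^ 3 \<le> 100 * card A * card B ^ 2"
proof -
  have "finite A" using cA by (simp add: convex_finset_def)
  define X where "X = {x. t \<le> rep A B x}"
  define n where "n = card A"
  define m where "m = card B"
  have finX: "finite X" unfolding X_def by (rule finite_rep_support) fact+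
  show ?thesis
  proof (cases "X = {} \<or> t < 4")
    case True
    then show ?thesis
    proof
      assume "t < 4"
      have "card X * t \<le> (\<Sum>x\<in>X. rep A B x)"
        using sum_bounded_below[of X t "rep A B"] by (auto simp: X_def)
      also have "\<dots> \<le> n * m" unfolding n_def m_def by (rule sum_rep_le) fact+
      finally have "card X * t * t ^ 2 \<le> n * m * t ^ 2" by simp
      also have "\<dots> \<le> n * m * 100"
        using \<open>t < 4\<close> power_mono[of t 3 2] by (intro mult_left_mono) auto
      also have "\<dots> \<le> 100 * n * m ^ 2" by (cases m) (auto simp: power2_eq_square)
      finally show ?thesis unfolding X_def n_def m_def by (simp add: power3_eq_cube power2_eq_square mult.assoc)
    qed (simp add: X_def)
  next
    case False
    then obtain x0 where "t \<le> rep A B x0" and t4: "t \<ge> 4" unfolding X_def by auto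
    then have tn: "t \<le> n" and tm: "t \<le> m"
      using rep_le_left[OF \<open>finite A\<close>, of B x0] rep_le_right[OF \<open>finite B\<close>, of A x0]
      unfolding n_def m_def by linarith+
    define u where "u = (!) (sorted_list_of_set A)"
    define v where "v = (!) (sorted_list_of_set B)"
    define K where "K = 4 * n div t + 1"
    define L where "L = 4 * m div t + 1"
    have K0: "K > 0" and L0: "L > 0" by (auto simp: K_def L_def)
    have u_less: "u i < u j \<longleftrightarrow> i < j" if "i < n" "j < n" for i j
      using sorted_list_of_set_nth_less_iff[OF \<open>finite A\<close>] that unfolding u_def n_def by blast
    have v_less: "v i < v j \<longleftrightarrow> i < j" if "i < m" "j < m" for i j
      using sorted_list_of_set_nth_less_iff[OF \<open>finite B\<close>] that unfolding v_def m_def by blast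
    have A_eq: "A = u ` {..<n}"
      using \<open>finite A\<close> unfolding u_def n_def
      by (metis length_sorted_list_of_set nth_image order_refl set_sorted_list_of_set take_all lessThan_atLeast0)
    have B_eq: "B = v ` {..<m}"
      using \<open>finite B\<close> unfolding v_def m_def
      by (metis length_sorted_list_of_set nth_image order_refl set_sorted_list_of_set take_all lessThan_atLeast0)
    have v_inj: "i = j" if "v i = v j" "i < m" "j < m" for i j
      using v_less[of i j] v_less[of j i] that by (metis less_irrefl linorder_neqE_nat)
    have u_inj: "i = j" if "u i = u j" "i < n" "j < n" for i j
      using u_less[of i j] u_less[of j i] that by (metis less_irrefl linorder_neqE_nat)
    define I where "I x = {(i, j). i < n \<and> j < m \<and> u i = v j + x}" for x
    \<comment> \<open>Among the representations of one \<open>x\<close>, the indices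
      \<open>i\<close> and \<open>j\<close> increase together. Hence equal sums of block indices
      force both block indices to agree, while the sum takes only about n/K + m/L values instead of
      a product.\<close>
    define f where "f = (\<lambda>(i, j). i div K + j div L)"
    define N where "N x = {p \<in> I x. \<exists>q\<in>I x. fst q < fst p \<and> f q = f p}" for x
    have finI: "finite (I x)" for x
      by (rule finite_subset[of _ "{..<n} \<times> {..<m}"]) (auto simp: I_def)
    have cardI: "card (I x) = rep A B x" for x
      unfolding rep_def
    proof (rule bij_betw_same_card[where f = "\<lambda>(i, j). v j"])
      show "bij_betw (\<lambda>(i, j). v j) (I x) {b \<in> B. b + x \<in> A}"
        unfolding bij_betw_def
      proof
        show "inj_on (\<lambda>(i, j). v j) (I x)"
          by (rule inj_onI) (auto simp: I_def intro: v_inj u_inj)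
        show "(\<lambda>(i, j). v j) ` I x = {b \<in> B. b + x \<in> A}"
          unfolding A_eq B_eq by (force simp: I_def image_iff)
      qed
    qed
    have order: "i' < i \<longleftrightarrow> j' < j" if "(i, j) \<in> I x" "(i', j') \<in> I x" for i j i' j' x
      using that u_less[of i' i] v_less[of j' j] by (auto simp: I_def)
    \<comment> \<open>The map \<open>f\<close> takes fewer than t/2 + 1 values on
      \<open>I x\<close>, and this is at most 3t/4 since \<open>t >= 4\<close>; at least t/4
      collisions remain.\<close>
    have N_card: "t \<le> 4 * card (N x)" if "x \<in> X" for x
    proof -
      have "inj_on fst (I x)"
        by (rule inj_onI) (auto simp: I_def intro: v_inj)
      from card_collisions_ge[OF finI this, of f]
      have 1: "card (I x) \<le> card (N x) + card (f ` I x)" unfolding N_def .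
      have "f ` I x \<subseteq> {..n div K + m div L}"
        by (auto simp: f_def I_def intro!: add_mono div_le_mono)
      then have "card (f ` I x) \<le> card {..n div K + m div L}" by (rule card_mono[rotated]) auto
      then have 2: "card (f ` I x) \<le> n div K + m div L + 1" by simp
      have "4 * (n div K) < t" "4 * (m div L) < t"
        unfolding K_def L_def using four_mult_div_less \<open>t \<ge> 1\<close> by blast+
      moreover have "t \<le> card (I x)" using that unfolding X_def cardI by simp
      ultimately show ?thesis using 1 2 t4 by linarith
    qed
    have finN: "finite (N x)" for x using finI unfolding N_def by simp
    define W where "W = (SIGMA x:X. N x)"
    have "\<forall>w\<in>W. \<exists>q. q \<in> I (fst w) \<and> fst q < fst (snd w) \<and> f q = f (snd w)"
      unfolding W_def N_def by fastforce
    then obtain g where g: "\<And>w. w \<in> W \<Longrightarrow> g w \<in> I (fst w) \<and> fst (g w) < fst (snd w) \<and> f (g w) = f (snd w)"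
      by metis
    \<comment> \<open>The code keeps \<open>j\<close> and the two index gaps to the partner
      \<open>(i', j')\<close>. It determines \<open>j'\<close>, hence the value
      \<open>u i - u i' = v j - v j'\<close>, from which \<open>x\<close> has cancelled; convexity
      then recovers \<open>i'\<close> from this value and \<open>i - i'\<close>.\<close>
    define h where "h w = (snd (snd w), snd (snd w) - snd (g w), fst (snd w) - fst (g w))" for w
    have W_props: "\<exists>i' j'. g (x, i, j) = (i', j') \<and> i < n \<and> j < m \<and> i' < i \<and> j' < j \<and>
        u i = v j + x \<and> u i' = v j' + x \<and> i - i' < K \<and> j - j' < L"
      if "(x, i, j) \<in> W" for x i j
    proof -
      obtain i' j' where gg: "g (x, i, j) = (i', j')" by fastforce
      have ij: "(i, j) \<in> I x" using that unfolding W_def N_def by auto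
      have ij': "(i', j') \<in> I x" "i' < i" "f (i', j') = f (i, j)" using g[OF that] gg by auto
      have "j' < j" using order[OF ij ij'(1)] ij'(2) by simp
      have "i' div K \<le> i div K" "j' div L \<le> j div L"
        using \<open>i' < i\<close> \<open>j' < j\<close> by (auto intro!: div_le_mono)
      then have "i' div K = i div K" "j' div L = j div L"
        using ij'(3) unfolding f_def by simp_all
      then have "i - i' < K" "j - j' < L"
        using same_block_diff_less[of i' i K] same_block_diff_less[of j' j L] \<open>i' < i\<close> \<open>j' < j\<close> K0 L0 by auto
      then show ?thesis using gg ij ij' \<open>j' < j\<close> unfolding I_def by auto
    qed
    have "inj_on h W"
    proof (rule inj_onI)
      fix w1 w2 assume w: "w1 \<in> W" "w2 \<in> W" and eq: "h w1 = h w2"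
      obtain x i j where w1: "w1 = (x, i, j)" by (metis prod.collapse)
      obtain y k l where w2: "w2 = (y, k, l)" by (metis prod.collapse)
      obtain i' j' where 1: "g w1 = (i', j')" "i < n" "j < m" "i' < i" "j' < j"
        "u i = v j + x" "u i' = v j' + x" using W_props[of x i j] w w1 by auto
      obtain k' l' where 2: "g w2 = (k', l')" "k < n" "l < m" "k' < k" "l' < l"
        "u k = v l + y" "u k' = v l' + y" using W_props[of y k l] w w2 by auto
      have e: "j = l" "j - j' = l - l'" "i - i' = k - k'"
        using eq 1(1) 2(1) unfolding h_def w1 w2 by auto
      have "j' = l'" using e 1 2 by auto
      then have gap: "u i - u i' = u k - u k'" using 1 2 e by simp
      have "i' = k'"
      proof (rule ccontr)
        assume "i' \<noteq> k'"
        define d where "d = i - i'"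
        have d: "i = i' + d" "k = k' + d" "d \<ge> 1" using 1 2 e unfolding d_def by auto
        from \<open>i' \<noteq> k'\<close> consider "i' < k'" | "k' < i'" by linarith
        then show False
          using convex_finset_gap_less[OF cA u_def, of i' k' d]
            convex_finset_gap_less[OF cA u_def, of k' i' d] gap 1(2) 2(2) d
          unfolding n_def by cases auto
      qed
      then have "i = k" using e 1 2 by auto
      then show "w1 = w2" using e 1 2 w1 w2 by auto
    qed
    moreover have "h ` W \<subseteq> {..<m} \<times> {..<L} \<times> {..<K}"
    proof
      fix z assume "z \<in> h ` W"
      then obtain x i j where "(x, i, j) \<in> W" "z = h (x, i, j)" by auto
      then show "z \<in> {..<m} \<times> {..<L} \<times> {..<K}"
        using W_props[of x i j] unfolding h_def by auto
    qed
    ultimately have "card W \<le> card ({..<m} \<times> {..<L} \<times> {..<K})"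
      by (intro card_inj_on_le) auto
    then have W_le: "card W \<le> m * (L * K)" by (simp add: card_cartesian_product)
    have "card X * t \<le> (\<Sum>x\<in>X. 4 * card (N x))"
      using sum_bounded_below[of X t "\<lambda>x. 4 * card (N x)"] N_card by auto
    also have "\<dots> = 4 * card W"
      unfolding W_def using finX finN by (subst card_SigmaI) (auto simp: sum_distrib_left)
    finally have Xt: "card X * t \<le> 4 * (m * (L * K))" using W_le by linarith
    \<comment> \<open>Rounding the block lengths up costs an extra \<open>t\<close>, absorbed by
      \<open>t <= n\<close> and \<open>t <= m\<close>.\<close>
    have "K * t \<le> 4 * n + t" "L * t \<le> 4 * m + t"
      unfolding K_def L_def by (simp_all add: algebra_simps)
    then have Kt: "K * t \<le> 5 * n" and Lt: "L * t \<le> 5 * m" using tn tm by linarith+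
    have "card X * t ^ 3 = (card X * t) * t * t" by (simp add: power3_eq_cube)
    also have "\<dots> \<le> 4 * (m * (L * K)) * t * t" using Xt by (intro mult_right_mono) auto
    also have "\<dots> = 4 * m * ((L * t) * (K * t))" by (simp add: algebra_simps)
    also have "\<dots> \<le> 4 * m * ((5 * m) * (5 * n))" using mult_mono[OF Lt Kt] by (intro mult_left_mono) auto
    also have "\<dots> = 100 * n * m ^ 2" by (simp add: power2_eq_square algebra_simps)
    finally show ?thesis unfolding X_def n_def m_def .
  qed
qed

section \<open>From level sets to moments, with a logarithmic loss\<close>

lemma harm_le_one_plus_ln: "harm n \<le> 1 + ln (real n)"
proof (cases n)
  case (Suc m)
  have "harm (Suc m) - ln (real (Suc m)) \<le> harm (Suc 0) - ln (real (Suc 0))"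
    using decseqD[OF decseq_harm_diff_ln, of 0 m] by simp
  then show ?thesis using Suc by (simp add: harm_def)
qed (simp add: harm_def)

text \<open>A discrete form of integrating the derivative of a power: the increment from
  \<open>m\<close> to \<open>m + 1\<close> is at most the derivative at the right endpoint.\<close>

lemma power_le_sum_powers:
  "real m ^ Suc k \<le> (\<Sum>t=1..m. real (Suc k) * real t ^ k)"
proof (induction m)
  case (Suc m)
  have "(real m + 1) ^ Suc j \<le> real m ^ Suc j + real (Suc j) * (real m + 1) ^ j" for j
  proof (induction j)
    case (Suc j)
    have "(real m + 1) ^ Suc (Suc j) \<le> (real m + 1) * (real m ^ Suc j + real (Suc j) * (real m + 1) ^ j)"
      using mult_left_mono[OF Suc, of "real m + 1"] by simp
    also have "\<dots> = real m ^ Suc (Suc j) + real m ^ Suc j + real (Suc j) * (real m + 1) ^ Suc j"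
      by (simp add: algebra_simps)
    also have "real m ^ Suc j \<le> (real m + 1) ^ Suc j" by (rule power_mono) auto
    finally show ?case by (simp add: algebra_simps)
  qed simp
  from this[of k] Suc show ?case by (simp add: add.commute)
qed simp

text \<open>Layer-cake summation: level \<open>t\<close> contributes at most
  \<open>Suc k * M / t\<close>, so the levels add up to a harmonic sum. All logarithms in the final
  bound originate here.\<close>

lemma sum_power_le_harm:
  fixes f :: "'a \<Rightarrow> nat"
  assumes "finite D" and le: "\<And>x. x \<in> D \<Longrightarrow> f x \<le> n"
    and M: "\<And>t. 1 \<le> t \<Longrightarrow> real (card {x \<in> D. t \<le> f x}) * real t ^ Suc k \<le> M"
  shows "(\<Sum>x\<in>D. real (f x) ^ Suc k) \<le> real (Suc k) * M * harm n"
proof -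
  have "(\<Sum>x\<in>D. real (f x) ^ Suc k) \<le> (\<Sum>x\<in>D. \<Sum>t=1..n. if t \<le> f x then real (Suc k) * real t ^ k else 0)"
  proof (rule sum_mono)
    fix x assume x: "x \<in> D"
    have "(\<Sum>t=1..n. if t \<le> f x then real (Suc k) * real t ^ k else 0) = (\<Sum>t=1..f x. real (Suc k) * real t ^ k)"
      using le[OF x] by (intro sum.mono_neutral_cong_right) auto
    then show "real (f x) ^ Suc k \<le> (\<Sum>t=1..n. if t \<le> f x then real (Suc k) * real t ^ k else 0)"
      using power_le_sum_powers[of "f x" k] by simp
  qed
  also have "\<dots> = (\<Sum>t=1..n. \<Sum>x\<in>D. if t \<le> f x then real (Suc k) * real t ^ k else 0)"
    by (rule sum.swap)
  also have "\<dots> \<le> (\<Sum>t=1..n. real (Suc k) * M * inverse (real t))"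
  proof (rule sum_mono)
    fix t assume "t \<in> {1..n}"
    then have t: "1 \<le> t" by simp
    have "(\<Sum>x\<in>D. if t \<le> f x then real (Suc k) * real t ^ k else 0)
        = real (card {x \<in> D. t \<le> f x}) * (real (Suc k) * real t ^ k)"
      using \<open>finite D\<close> by (simp add: sum.inter_filter[symmetric])
    also have "\<dots> = real (Suc k) * (real (card {x \<in> D. t \<le> f x}) * real t ^ Suc k) * inverse (real t)"
      using t by (simp add: field_simps)
    also have "\<dots> \<le> real (Suc k) * M * inverse (real t)"
      using M[OF t] by (intro mult_right_mono mult_left_mono) auto
    finally show "(\<Sum>x\<in>D. if t \<le> f x then real (Suc k) * real t ^ k else 0) \<le> real (Suc k) * M * inverse (real t)" .
  qed
  also have "\<dots> = real (Suc k) * M * harm n" by (simp add: harm_def sum_distrib_left)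
  finally show ?thesis .
qed

text \<open>The factor 300 is the 100 of \<open>card_popular_differences\<close> times the 3 from
  summing cubes over levels. As \<open>ln 0 = 0\<close>, the value at 0 is 300.\<close>

definition log_loss :: "nat \<Rightarrow> real" where
  "log_loss n = 300 * (1 + ln (real n))"

lemma log_loss_ge: "log_loss n \<ge> 300"
  unfolding log_loss_def by (cases n) auto

lemma sum_rep_cubed_le:
  assumes cA: "convex_finset A" and "finite B" "finite D"
  shows "(\<Sum>x\<in>D. real (rep A B x) ^ 3) \<le> log_loss (card A) * real (card A) * real (card B) ^ 2"
proof -
  have finA: "finite A" using cA by (simp add: convex_finset_def)
  let ?M = "100 * real (card A) * real (card B) ^ 2"
  have *: "real (card {x \<in> D. t \<le> rep A B x}) * real t ^ Suc 2 \<le> ?M" if t: "1 \<le> t" for t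
  proof -
    have "card {x \<in> D. t \<le> rep A B x} \<le> card {x. t \<le> rep A B x}"
      by (rule card_mono[OF finite_rep_support[OF finA \<open>finite B\<close> t]]) auto
    then have "card {x \<in> D. t \<le> rep A B x} * t ^ 3 \<le> 100 * card A * card B ^ 2"
      using card_popular_differences[OF cA \<open>finite B\<close> t] by (meson le_trans mult_le_mono1)
    then have "real (card {x \<in> D. t \<le> rep A B x} * t ^ 3) \<le> real (100 * card A * card B ^ 2)"
      by (simp only: of_nat_le_iff)
    then show ?thesis by (simp add: numeral_3_eq_3)
  qed
  have "(\<Sum>x\<in>D. real (rep A B x) ^ Suc 2) \<le> real (Suc 2) * ?M * harm (card A)"
    by (rule sum_power_le_harm[OF \<open>finite D\<close> _ *]) (use finA rep_le_left in auto)
  also have "\<dots> \<le> real (Suc 2) * ?M * (1 + ln (real (card A)))"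
    by (intro mult_left_mono harm_le_one_plus_ln) auto
  finally show ?thesis by (simp add: log_loss_def algebra_simps numeral_3_eq_3)
qed

section \<open>Cauchy-Schwarz and Hoelder inequalities for counting\<close>

text \<open>Cauchy-Schwarz applied to the fibre sizes of \<open>F\<close>, whose squares sum to the
  number of colliding pairs.\<close>

lemma card_squared_le_collisions:
  assumes "finite T" "finite W" "F ` T \<subseteq> W"
  shows "(card T)\<^sup>2 \<le> card W * card {(u, v). u \<in> T \<and> v \<in> T \<and> F u = F v}"
proof -
  let ?fib = "\<lambda>w. {u \<in> T. F u = w}"
  have "card T = (\<Sum>w\<in>W. card (?fib w))"
    using card_eq_sum[of T] sum.group[OF assms, of "\<lambda>_. 1 :: nat"] by simp
  then have "real (card T) = (\<Sum>w\<in>W. real (card (?fib w)))" by simp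
  then have "(real (card T))\<^sup>2 \<le> (\<Sum>w\<in>W. (real (card (?fib w)))\<^sup>2) * real (card W)"
    using sum_squared_le_sum_of_squares[of "\<lambda>w. real (card (?fib w))" W] assms(2) by simp
  also have "(\<Sum>w\<in>W. (real (card (?fib w)))\<^sup>2) = real (\<Sum>w\<in>W. card (?fib w \<times> ?fib w))"
    by (simp add: card_cartesian_product power2_eq_square)
  also have "(\<Sum>w\<in>W. card (?fib w \<times> ?fib w)) = card (SIGMA w:W. ?fib w \<times> ?fib w)"
    using assms by (subst card_SigmaI) auto
  also have "\<dots> \<le> card {(u, v). u \<in> T \<and> v \<in> T \<and> F u = F v}"
  proof (rule card_inj_on_le[where f = snd])
    show "finite {(u, v). u \<in> T \<and> v \<in> T \<and> F u = F v}"
      by (rule finite_subset[of _ "T \<times> T"]) (use assms in auto)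
  qed (auto simp: inj_on_def)
  finally have "real ((card T)\<^sup>2) \<le> real (card {(u, v). u \<in> T \<and> v \<in> T \<and> F u = F v} * card W)"
    by (simp add: mult_right_mono)
  then show ?thesis by (simp only: of_nat_le_iff mult.commute)
qed

text \<open>If \<open>(a, b, c)\<close> and \<open>(a', b', c')\<close> have the same image, then
  \<open>t = a - a' = b' - b = c' - c\<close>. A collision thus gives three representations of one
  \<open>t\<close>, whence the third moment.\<close>

lemma card_triples_squared_le:
  fixes A :: "real set"
  assumes "finite A" "T \<subseteq> A \<times> A \<times> A" "finite W" "(\<lambda>(a, b, c). (a + b, a + c)) ` T \<subseteq> W"
  shows "(card T)\<^sup>2 \<le> card W * (\<Sum>t\<in>(\<lambda>(a, b). a - b) ` (A \<times> A). rep A A t ^ 3)"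
proof -
  let ?F = "\<lambda>(a, b, c). (a + b, a + c) :: real \<times> real"
  let ?D = "(\<lambda>(a, b). a - b) ` (A \<times> A)"
  let ?R = "\<lambda>t. {b \<in> A. b + t \<in> A}"
  have finT: "finite T" using assms(1,2) by (rule_tac finite_subset) auto
  have "card {(u, v). u \<in> T \<and> v \<in> T \<and> ?F u = ?F v} \<le> card (SIGMA t:?D. ?R t \<times> ?R t \<times> ?R t)"
  proof (rule card_inj_on_le[where f = "\<lambda>((a, b, c), (a', b', c')). (a - a', a', b, c)"])
    show "inj_on (\<lambda>((a, b, c), (a', b', c')). (a - a', a', b, c)) {(u, v). u \<in> T \<and> v \<in> T \<and> ?F u = ?F v}"
      by (auto simp: inj_on_def)
    show "(\<lambda>((a, b, c), (a', b', c')). (a - a', a', b, c)) ` {(u, v). u \<in> T \<and> v \<in> T \<and> ?F u = ?F v}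
        \<subseteq> (SIGMA t:?D. ?R t \<times> ?R t \<times> ?R t)"
    proof
      fix z assume "z \<in> (\<lambda>((a, b, c), (a', b', c')). (a - a', a', b, c)) ` {(u, v). u \<in> T \<and> v \<in> T \<and> ?F u = ?F v}"
      then obtain a b c a' b' c' where T: "(a, b, c) \<in> T" "(a', b', c') \<in> T"
        and eq: "a + b = a' + b'" "a + c = a' + c'" and z: "z = (a - a', a', b, c)" by auto
      have "b + (a - a') = b'" "c + (a - a') = c'" using eq by auto
      moreover have "a \<in> A" "b \<in> A" "c \<in> A" "a' \<in> A" "b' \<in> A" "c' \<in> A" using T assms(2) by auto
      ultimately show "z \<in> (SIGMA t:?D. ?R t \<times> ?R t \<times> ?R t)" unfolding z by auto
    qed
  qed (use \<open>finite A\<close> in auto)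
  also have "\<dots> = (\<Sum>t\<in>?D. rep A A t ^ 3)"
    using \<open>finite A\<close> by (subst card_SigmaI) (auto simp: rep_def card_cartesian_product power3_eq_cube mult.assoc)
  finally show ?thesis
    using card_squared_le_collisions[OF finT assms(3,4)] by (meson le_trans mult_le_mono2)
qed

text \<open>The collisions of \<open>a + b\<close> are counted by the additive energy:
  \<open>a + b = a' + b'\<close> means \<open>a - a' = b' - b\<close>, two representations of one
  difference.\<close>

lemma card_power4_le_energy:
  fixes A :: "real set"
  assumes "finite A"
  shows "card A ^ 4 \<le> card (A + A) * (\<Sum>t\<in>(\<lambda>(a, b). a - b) ` (A \<times> A). rep A A t ^ 2)"
proof -
  let ?F = "\<lambda>(a, b). a + b :: real"
  let ?D = "(\<lambda>(a, b). a - b) ` (A \<times> A)"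
  let ?R = "\<lambda>t. {b \<in> A. b + t \<in> A}"
  have finS: "finite (A + A)" using assms by (rule finite_set_plus) fact
  have "card {(u, v). u \<in> A \<times> A \<and> v \<in> A \<times> A \<and> ?F u = ?F v} \<le> card (SIGMA t:?D. ?R t \<times> ?R t)"
  proof (rule card_inj_on_le[where f = "\<lambda>((a, b), (a', b')). (a - a', a', b)"])
    show "inj_on (\<lambda>((a, b), (a', b')). (a - a', a', b)) {(u, v). u \<in> A \<times> A \<and> v \<in> A \<times> A \<and> ?F u = ?F v}"
      by (auto simp: inj_on_def)
    show "(\<lambda>((a, b), (a', b')). (a - a', a', b)) ` {(u, v). u \<in> A \<times> A \<and> v \<in> A \<times> A \<and> ?F u = ?F v}
        \<subseteq> (SIGMA t:?D. ?R t \<times> ?R t)"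
    proof
      fix z assume "z \<in> (\<lambda>((a, b), (a', b')). (a - a', a', b)) ` {(u, v). u \<in> A \<times> A \<and> v \<in> A \<times> A \<and> ?F u = ?F v}"
      then obtain a b a' b' where A: "a \<in> A" "b \<in> A" "a' \<in> A" "b' \<in> A"
        and eq: "a + b = a' + b'" and z: "z = (a - a', a', b)" by auto
      have "b + (a - a') = b'" using eq by auto
      then show "z \<in> (SIGMA t:?D. ?R t \<times> ?R t)" unfolding z using A by auto
    qed
  qed (use \<open>finite A\<close> in auto)
  also have "\<dots> = (\<Sum>t\<in>?D. rep A A t ^ 2)"
    using \<open>finite A\<close> by (subst card_SigmaI) (auto simp: rep_def card_cartesian_product power2_eq_square)
  finally have "card {(u, v). u \<in> A \<times> A \<and> v \<in> A \<times> A \<and> ?F u = ?F v} \<le> (\<Sum>t\<in>?D. rep A A t ^ 2)" .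
  moreover have "(card (A \<times> A))\<^sup>2 \<le> card (A + A) * card {(u, v). u \<in> A \<times> A \<and> v \<in> A \<times> A \<and> ?F u = ?F v}"
    by (rule card_squared_le_collisions) (use assms finS in \<open>auto simp: set_plus_intro\<close>)
  ultimately have "(card (A \<times> A))\<^sup>2 \<le> card (A + A) * (\<Sum>t\<in>?D. rep A A t ^ 2)"
    by (meson le_trans mult_le_mono2)
  then show ?thesis by (simp add: card_cartesian_product power2_eq_square power4_eq_xxxx mult.assoc)
qed

text \<open>Optimising over \<open>c\<close> turns this into Hoelder's inequality with exponents \<open>2, 6, 3\<close> applied to
  \<open>f\<^bsup>1/2\<^esup> \<cdot> f\<^bsup>1/2\<^esup> \<cdot> g\<close>.\<close>
lemma sum_mult_squared_le:
  fixes f g :: "'a \<Rightarrow> real"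
  assumes "c > 0" "\<And>x. x \<in> D \<Longrightarrow> f x \<ge> 0" "\<And>x. x \<in> D \<Longrightarrow> g x \<ge> 0"
  shows "(\<Sum>x\<in>D. f x * g x)\<^sup>2 \<le> (\<Sum>x\<in>D. f x) * (c\<^sup>2 * (\<Sum>x\<in>D. f x ^ 3) + (\<Sum>x\<in>D. g x ^ 3) / c)"
proof -
  have pt: "f x * (g x)\<^sup>2 \<le> c\<^sup>2 * f x ^ 3 + g x ^ 3 / c" if "x \<in> D" for x
  proof (cases "g x \<le> c * f x")
    case True
    have "f x * (g x)\<^sup>2 \<le> f x * (c * f x)\<^sup>2"
      using True assms that by (intro mult_left_mono power_mono) auto
    also have "\<dots> = c\<^sup>2 * f x ^ 3" by (simp add: power2_eq_square power3_eq_cube)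
    finally show ?thesis using assms that by (simp add: add_increasing2)
  next
    case False
    have "f x * (g x)\<^sup>2 \<le> g x / c * (g x)\<^sup>2"
      using False assms that by (intro mult_right_mono) (auto simp: field_simps)
    also have "\<dots> = g x ^ 3 / c" by (simp add: power2_eq_square power3_eq_cube)
    finally show ?thesis using assms that by (simp add: add_increasing)
  qed
  have "(\<Sum>x\<in>D. sqrt (f x) * (sqrt (f x) * g x))\<^sup>2 \<le> (\<Sum>x\<in>D. (sqrt (f x))\<^sup>2) * (\<Sum>x\<in>D. (sqrt (f x) * g x)\<^sup>2)"
    by (rule Cauchy_Schwarz_ineq_sum)
  moreover have "(\<Sum>x\<in>D. sqrt (f x) * (sqrt (f x) * g x)) = (\<Sum>x\<in>D. f x * g x)"
    by (rule sum.cong) (use assms in \<open>auto simp: mult.assoc[symmetric]\<close>)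
  moreover have "(\<Sum>x\<in>D. (sqrt (f x))\<^sup>2) = (\<Sum>x\<in>D. f x)"
    by (rule sum.cong) (use assms in auto)
  moreover have "(\<Sum>x\<in>D. (sqrt (f x) * g x)\<^sup>2) = (\<Sum>x\<in>D. f x * (g x)\<^sup>2)"
    by (rule sum.cong) (use assms in \<open>auto simp: power_mult_distrib\<close>)
  moreover have "(\<Sum>x\<in>D. f x * (g x)\<^sup>2) \<le> (\<Sum>x\<in>D. c\<^sup>2 * f x ^ 3 + g x ^ 3 / c)"
    by (rule sum_mono[OF pt])
  moreover have "(\<Sum>x\<in>D. c\<^sup>2 * f x ^ 3 + g x ^ 3 / c) = c\<^sup>2 * (\<Sum>x\<in>D. f x ^ 3) + (\<Sum>x\<in>D. g x ^ 3) / c"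
    by (simp add: sum.distrib sum_distrib_left sum_divide_distrib)
  moreover have "(\<Sum>x\<in>D. f x) \<ge> 0" by (rule sum_nonneg) (use assms in auto)
  ultimately show ?thesis by (metis (no_types, lifting) mult_left_mono order_trans)
qed

section \<open>Pairs of popular sums with difference in a given set\<close>

text \<open>A pair \<open>(x, y)\<close> in \<open>W\<close> and a representation
  \<open>x = a + b\<close> give \<open>a - d = y - b\<close> with \<open>d = x - y\<close> in
  \<open>P\<close>. The solutions are counted by a sum of products of two representation functions,
  whose third moments are controlled because \<open>A\<close> is convex.\<close>

lemma card_popular_pairs_le:
  fixes A P S S' :: "real set"
  assumes cA: "convex_finset A" and fin: "finite P" "finite S" and ne: "P \<noteq> {}" "S \<noteq> {}"
    and S': "S' \<subseteq> S" and k: "k \<ge> 0" "\<And>x. x \<in> S' \<Longrightarrow> k \<le> real (card {a \<in> A. x - a \<in> A})"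
  defines "W \<equiv> {(x, y). x \<in> S' \<and> y \<in> S' \<and> x - y \<in> P}"
  shows "(real (card W) * k) ^ 6
    \<le> 8 * log_loss (card A) ^ 3 * real (card A) ^ 6 * real (card P) ^ 5 * real (card S) ^ 4"
proof -
  have finA: "finite A" using cA by (simp add: convex_finset_def)
  have finS': "finite S'" using S' fin(2) by (rule finite_subset)
  have finW: "finite W"
    by (rule finite_subset[of _ "S' \<times> S'"]) (use finS' in \<open>auto simp: W_def\<close>)
  define n p s L where "n = real (card A)" "p = real (card P)" "s = real (card S)" "L = log_loss (card A)"
  have p: "p > 0" and s: "s > 0" using fin ne unfolding n_p_s_L_def by (auto simp: card_gt_0_iff)
  have n: "n \<ge> 0" and L: "L > 0" using log_loss_ge[of "card A"] unfolding n_p_s_L_def by auto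
  define D where "D = (\<lambda>(a, d). a - d) ` (A \<times> P)"
  have finD: "finite D" unfolding D_def using finA fin by auto
  \<comment> \<open>\<open>g z\<close> counts the representations \<open>z = y - b\<close> with
    \<open>y\<close> in \<open>S\<close> and \<open>b\<close> in \<open>A\<close>. The sign puts the
    convex set first, as \<open>sum_rep_cubed_le\<close> requires.\<close>
  define f g where "f z = real (rep A P z)" and "g z = real (rep A S (- z))" for z
  define Y where "Y = (\<Sum>z\<in>D. f z * g z)"
  have "real (card W) * k \<le> (\<Sum>w\<in>W. real (card {a \<in> A. fst w - a \<in> A}))"
    by (rule sum_bounded_below) (use k in \<open>auto simp: W_def\<close>)
  also have "\<dots> = real (card (SIGMA w:W. {a \<in> A. fst w - a \<in> A}))"
    using finW finA by (subst card_SigmaI) auto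
  also have "card (SIGMA w:W. {a \<in> A. fst w - a \<in> A})
      \<le> card (SIGMA z:D. {d \<in> P. d + z \<in> A} \<times> {y \<in> S. y + - z \<in> A})"
  proof (rule card_inj_on_le[where f = "\<lambda>((x, y), a). (a - (x - y), x - y, y)"])
    show "(\<lambda>((x, y), a). (a - (x - y), x - y, y)) ` (SIGMA w:W. {a \<in> A. fst w - a \<in> A})
        \<subseteq> (SIGMA z:D. {d \<in> P. d + z \<in> A} \<times> {y \<in> S. y + - z \<in> A})"
    proof
      fix q assume "q \<in> (\<lambda>((x, y), a). (a - (x - y), x - y, y)) ` (SIGMA w:W. {a \<in> A. fst w - a \<in> A})"
      then obtain x y a where q: "q = (a - (x - y), x - y, y)" and h: "(x, y) \<in> W" "a \<in> A" "x - a \<in> A"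
        by auto
      have "a - (x - y) \<in> D"
        unfolding D_def using h by (intro image_eqI[where x = "(a, x - y)"]) (auto simp: W_def)
      moreover have "y + - (a - (x - y)) = x - a" by simp
      ultimately show "q \<in> (SIGMA z:D. {d \<in> P. d + z \<in> A} \<times> {y \<in> S. y + - z \<in> A})"
        using h S' unfolding q W_def by auto
    qed
  qed (use finD fin in \<open>auto simp: inj_on_def\<close>)
  also have "real (card (SIGMA z:D. {d \<in> P. d + z \<in> A} \<times> {y \<in> S. y + - z \<in> A})) = Y"
    unfolding Y_def f_def g_def rep_def using finD fin
    by (subst card_SigmaI) (auto simp: card_cartesian_product)
  finally have WY: "real (card W) * k \<le> Y" by simp
  \<comment> \<open>This \<open>c\<close> balances the two cubic terms:
    \<open>c^2 * p^2 = s^2 / c\<close>.\<close>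
  define c where "c = root 3 ((s / p)\<^sup>2)"
  have c: "c > 0" unfolding c_def using s p by simp
  have c3: "c ^ 3 * p\<^sup>2 = s\<^sup>2" unfolding c_def using s p by (simp add: power_divide)
  have "(\<Sum>z\<in>D. f z ^ 3) \<le> L * n * p\<^sup>2"
    unfolding f_def n_p_s_L_def by (rule sum_rep_cubed_le) fact+
  then have f3: "c\<^sup>2 * (\<Sum>z\<in>D. f z ^ 3) \<le> c\<^sup>2 * (L * n * p\<^sup>2)" by (intro mult_left_mono) auto
  have "(\<Sum>z\<in>D. g z ^ 3) = (\<Sum>z\<in>uminus ` D. real (rep A S z) ^ 3)"
    unfolding g_def by (subst sum.reindex) (auto simp: inj_on_def)
  also have "\<dots> \<le> L * n * s\<^sup>2"
    unfolding n_p_s_L_def by (rule sum_rep_cubed_le) (use cA fin finD in auto)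
  finally have "(\<Sum>z\<in>D. g z ^ 3) / c \<le> L * n * s\<^sup>2 / c" using c by (intro divide_right_mono) auto
  also have "\<dots> = c\<^sup>2 * (L * n * p\<^sup>2)"
    unfolding c3[symmetric] using c by (simp add: power2_eq_square power3_eq_cube)
  finally have g3: "(\<Sum>z\<in>D. g z ^ 3) / c \<le> c\<^sup>2 * (L * n * p\<^sup>2)" .
  have f1: "(\<Sum>z\<in>D. f z) \<le> n * p"
    using sum_rep_le[OF finA fin(1) finD] unfolding f_def n_p_s_L_def
    by (metis of_nat_le_iff of_nat_mult of_nat_sum)
  have "Y\<^sup>2 \<le> (\<Sum>z\<in>D. f z) * (c\<^sup>2 * (\<Sum>z\<in>D. f z ^ 3) + (\<Sum>z\<in>D. g z ^ 3) / c)"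
    unfolding Y_def by (rule sum_mult_squared_le) (use c in \<open>auto simp: f_def g_def\<close>)
  also have "\<dots> \<le> (n * p) * (2 * (c\<^sup>2 * (L * n * p\<^sup>2)))"
  proof (rule mult_mono[OF f1])
    show "c\<^sup>2 * (\<Sum>z\<in>D. f z ^ 3) + (\<Sum>z\<in>D. g z ^ 3) / c \<le> 2 * (c\<^sup>2 * (L * n * p\<^sup>2))"
      using f3 g3 by simp
    show "0 \<le> c\<^sup>2 * (\<Sum>z\<in>D. f z ^ 3) + (\<Sum>z\<in>D. g z ^ 3) / c"
      using c by (intro add_nonneg_nonneg mult_nonneg_nonneg divide_nonneg_pos sum_nonneg)
        (auto simp: f_def g_def)
  qed (use n p in auto)
  finally have Y2: "Y\<^sup>2 \<le> (n * p) * (2 * (c\<^sup>2 * (L * n * p\<^sup>2)))" .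
  have "(real (card W) * k) ^ 6 \<le> Y ^ 6" using WY k(1) by (intro power_mono) auto
  also have "\<dots> = (Y\<^sup>2) ^ 3" by (simp add: power_mult[symmetric])
  also have "\<dots> \<le> ((n * p) * (2 * (c\<^sup>2 * (L * n * p\<^sup>2)))) ^ 3" using Y2 by (intro power_mono) auto
  also have "\<dots> = 8 * L ^ 3 * n ^ 6 * p ^ 5 * (c ^ 3 * p\<^sup>2)\<^sup>2" by algebra
  also have "\<dots> = 8 * L ^ 3 * n ^ 6 * p ^ 5 * s ^ 4" unfolding c3 by algebra
  finally show ?thesis unfolding n_p_s_L_def .
qed

text \<open>The number \<open>N\<close> of pairs of popular sums with difference in \<open>P\<close>
  is bounded below through the triples in \<open>T\<close> and above by
  \<open>card_popular_pairs_le\<close>; eliminating \<open>N\<close> leaves the claim.\<close>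

lemma popular_difference_level_le:
  fixes A A' S S' :: "real set"
  assumes cA: "convex_finset A" and A: "A' \<subseteq> A" "A \<noteq> {}" and S: "finite S" "S' \<subseteq> S" "S \<noteq> {}"
    and pop: "\<And>x. x \<in> S' \<Longrightarrow> (real (card A))\<^sup>2 \<le> 8 * real (card S) * real (card {a \<in> A. x - a \<in> A})"
    and common: "\<And>b c. b \<in> A' \<Longrightarrow> c \<in> A' \<Longrightarrow> card A \<le> 2 * card {a \<in> A. a + b \<in> S' \<and> a + c \<in> S'}"
    and t: "t \<ge> 1"
  defines "P \<equiv> {d. t \<le> rep A' A' d}"
  shows "real (card P) ^ 7 * real t ^ 12 \<le> 2 ^ 33 * log_loss (card A) ^ 9 * real (card S) ^ 10"
proof (cases "P = {}")
  case False
  have finA: "finite A" using cA by (simp add: convex_finset_def)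
  have finA': "finite A'" using A(1) finA by (rule finite_subset)
  have finS': "finite S'" using S by (auto intro: finite_subset)
  have finP: "finite P" unfolding P_def by (rule finite_rep_support) fact+
  define n p s L \<tau> where "n = real (card A)" "p = real (card P)" "s = real (card S)"
    "L = log_loss (card A)" "\<tau> = real t"
  note defs = n_p_s_L_\<tau>_def
  have n: "n > 0" and p: "p > 0" and s: "s > 0"
    using finA A finP False S unfolding defs by (auto simp: card_gt_0_iff)
  have L: "L > 0" using log_loss_ge[of "card A"] unfolding defs by auto
  define W where "W = {(x, y). x \<in> S' \<and> y \<in> S' \<and> x - y \<in> P}"
  define N where "N = real (card W)"
  have finW: "finite W"
    by (rule finite_subset[of _ "S' \<times> S'"]) (use finS' in \<open>auto simp: W_def\<close>)
  \<comment> \<open>An element \<open>(d, c)\<close> stands for the pair \<open>(c + d, c)\<close>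
    in \<open>A'\<close> with difference in \<open>P\<close>. There are at least
    \<open>card P * t\<close> of them, and each extends to at least n/2 triples in
    \<open>T\<close>.\<close>
  define Q where "Q = (SIGMA d:P. {c \<in> A'. c + d \<in> A'})"
  have finQ: "finite Q" unfolding Q_def using finP finA' by auto
  define T where "T = {(a, b, c). a \<in> A \<and> b \<in> A' \<and> c \<in> A' \<and> a + b \<in> S' \<and> a + c \<in> S' \<and> b - c \<in> P}"
  have TA: "T \<subseteq> A \<times> A \<times> A" unfolding T_def using A by auto
  have finT: "finite T" using TA by (rule finite_subset) (use finA in auto)
  have "card P * t \<le> (\<Sum>d\<in>P. rep A' A' d)"
    using sum_bounded_below[of P t "rep A' A'"] by (auto simp: P_def)
  also have "\<dots> = card Q" unfolding Q_def rep_def using finP finA' by (subst card_SigmaI) auto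
  finally have Q: "card P * t \<le> card Q" .
  have "card Q * card A \<le> (\<Sum>q\<in>Q. 2 * card {a \<in> A. a + (snd q + fst q) \<in> S' \<and> a + snd q \<in> S'})"
    using sum_bounded_below[of Q "card A" "\<lambda>q. 2 * card {a \<in> A. a + (snd q + fst q) \<in> S' \<and> a + snd q \<in> S'}"]
      common by (auto simp: Q_def)
  also have "\<dots> = 2 * card (SIGMA q:Q. {a \<in> A. a + (snd q + fst q) \<in> S' \<and> a + snd q \<in> S'})"
    using finQ finA by (subst card_SigmaI) (auto simp: sum_distrib_left)
  also have "card (SIGMA q:Q. {a \<in> A. a + (snd q + fst q) \<in> S' \<and> a + snd q \<in> S'}) \<le> card T"
    by (rule card_inj_on_le[where f = "\<lambda>((d, c), a). (a, c + d, c)"])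
       (use finT in \<open>auto simp: inj_on_def T_def Q_def\<close>)
  finally have "card P * t * card A \<le> 2 * card T" using Q by (meson le_trans mult_le_mono1 mult_le_mono2)
  then have "real (card P * t * card A) \<le> real (2 * card T)" by (simp only: of_nat_le_iff)
  then have T1: "p * \<tau> * n \<le> 2 * real (card T)" unfolding defs by simp
  have "(card T)\<^sup>2 \<le> card W * (\<Sum>t\<in>(\<lambda>(a, b). a - b) ` (A \<times> A). rep A A t ^ 3)"
    by (rule card_triples_squared_le[OF finA TA finW]) (auto simp: T_def W_def)
  then have "real ((card T)\<^sup>2) \<le> real (card W * (\<Sum>t\<in>(\<lambda>(a, b). a - b) ` (A \<times> A). rep A A t ^ 3))"
    by (simp only: of_nat_le_iff)
  then have "(real (card T))\<^sup>2 \<le> N * (\<Sum>t\<in>(\<lambda>(a, b). a - b) ` (A \<times> A). real (rep A A t) ^ 3)"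
    unfolding N_def by simp
  also have "\<dots> \<le> N * (L * n * n\<^sup>2)"
    unfolding defs N_def by (intro mult_left_mono sum_rep_cubed_le) (use cA finA in auto)
  finally have T2: "(real (card T))\<^sup>2 \<le> N * (L * n * n\<^sup>2)" .
  have "(p * \<tau> * n)\<^sup>2 \<le> (2 * real (card T))\<^sup>2"
    using T1 n p unfolding defs by (intro power_mono) auto
  also have "\<dots> \<le> 4 * (N * (L * n * n\<^sup>2))" using T2 by (simp add: power_mult_distrib)
  finally have "n\<^sup>2 * (p * \<tau>)\<^sup>2 \<le> n\<^sup>2 * (4 * N * L * n)" by (simp add: algebra_simps power2_eq_square)
  then have pt: "(p * \<tau>)\<^sup>2 \<le> 4 * N * L * n" using n by simp
  have pop': "n\<^sup>2 / (8 * s) \<le> real (card {a \<in> A. x - a \<in> A})" if "x \<in> S'" for x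
    using pop[OF that] s unfolding defs by (simp add: field_simps)
  have "(N * (n\<^sup>2 / (8 * s))) ^ 6 \<le> 8 * L ^ 3 * n ^ 6 * p ^ 5 * s ^ 4"
    unfolding N_def W_def using card_popular_pairs_le[OF cA finP S(1) False S(3,2) _ pop'] s
    unfolding defs by simp
  \<comment> \<open>The constant is 8 * 8^6 = 2^21.\<close>
  then have NN: "N ^ 6 * n ^ 12 \<le> 2 ^ 21 * L ^ 3 * n ^ 6 * p ^ 5 * s ^ 10"
    using s by (simp add: power_mult_distrib power_divide field_simps power_mult[symmetric])
  \<comment> \<open>The factor \<open>p ^ 5 * n ^ 12\<close> reappears on the right and cancels; the
    constant is 4^6 * 2^21 = 2^33.\<close>
  have "p ^ 5 * n ^ 12 * (p ^ 7 * \<tau> ^ 12) = ((p * \<tau>)\<^sup>2) ^ 6 * n ^ 12" by algebra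
  also have "\<dots> \<le> (4 * N * L * n) ^ 6 * n ^ 12"
    using pt n by (intro mult_right_mono power_mono) auto
  also have "\<dots> = 2 ^ 12 * L ^ 6 * n ^ 6 * (N ^ 6 * n ^ 12)" by algebra
  also have "\<dots> \<le> 2 ^ 12 * L ^ 6 * n ^ 6 * (2 ^ 21 * L ^ 3 * n ^ 6 * p ^ 5 * s ^ 10)"
    using NN L n by (intro mult_left_mono) auto
  also have "\<dots> = p ^ 5 * n ^ 12 * (2 ^ 33 * L ^ 9 * s ^ 10)" by algebra
  finally show ?thesis using p n unfolding defs by simp
qed (use log_loss_ge[of "card A"] in simp)

section \<open>A large subset whose elements share many popular sums\<close>

text \<open>Each of the \<open>s\<close> sums outside \<open>S'\<close> has fewer than n^2/(8s)
  representations, so at most n^2/8 pairs have an unpopular sum. By Markov at most n/2 elements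
  \<open>b\<close> are in more than n/4 such pairs, and two of the remaining elements together
  exclude at most n/2 values of \<open>a\<close>.\<close>

lemma popular_sum_structure:
  fixes A :: "real set"
  assumes finA: "finite A" and "A \<noteq> {}"
  defines "r \<equiv> \<lambda>x. card {a \<in> A. x - a \<in> A}"
  defines "S' \<equiv> {x \<in> A + A. (card A)\<^sup>2 \<le> 8 * card (A + A) * r x}"
  defines "A' \<equiv> {b \<in> A. 4 * card {a \<in> A. a + b \<notin> S'} \<le> card A}"
  shows "card A \<le> 2 * card A'"
    and "\<And>b c. b \<in> A' \<Longrightarrow> c \<in> A' \<Longrightarrow> card A \<le> 2 * card {a \<in> A. a + b \<in> S' \<and> a + c \<in> S'}"
proof -
  define n where "n = card A"
  define s where "s = card (A + A)"
  have finS: "finite (A + A)" using finA by (rule finite_set_plus) fact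
  have n: "n > 0" using assms(1,2) unfolding n_def by (simp add: card_gt_0_iff)
  have "A + A \<noteq> {}" using \<open>A \<noteq> {}\<close> by (auto simp: set_plus_def)
  then have s: "s > 0" using finS unfolding s_def by (simp add: card_gt_0_iff)
  define Bad where "Bad = (SIGMA b:A. {a \<in> A. a + b \<notin> S'})"
  have finB: "finite Bad" unfolding Bad_def using finA by auto
  have "card Bad \<le> card (SIGMA x:(A + A) - S'. {a \<in> A. x - a \<in> A})"
    by (rule card_inj_on_le[where f = "\<lambda>(b, a). (a + b, a)"])
       (use finA finS in \<open>auto simp: inj_on_def Bad_def set_plus_intro\<close>)
  also have "\<dots> = (\<Sum>x\<in>(A + A) - S'. r x)"
    unfolding r_def using finA finS by (subst card_SigmaI) auto
  finally have "8 * s * card Bad \<le> (\<Sum>x\<in>(A + A) - S'. 8 * s * r x)"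
    by (simp add: sum_distrib_left[symmetric])
  also have "\<dots> \<le> (\<Sum>x\<in>(A + A) - S'. n\<^sup>2)"
    by (rule sum_mono) (auto simp: S'_def n_def s_def)
  also have "\<dots> = card ((A + A) - S') * n\<^sup>2" by simp
  also have "\<dots> \<le> s * n\<^sup>2"
    unfolding s_def by (intro mult_right_mono card_mono) (use finS in auto)
  finally have "s * (8 * card Bad) \<le> s * n\<^sup>2" by (simp add: algebra_simps)
  then have bad: "8 * card Bad \<le> n\<^sup>2" using s by simp
  have "card (A - A') * n \<le> (\<Sum>b\<in>A - A'. 4 * card {a \<in> A. a + b \<notin> S'})"
  proof -
    have "n \<le> 4 * card {a \<in> A. a + b \<notin> S'}" if "b \<in> A - A'" for b
      using that unfolding A'_def n_def by auto
    from sum_bounded_below[of "A - A'", OF this] show ?thesis by simp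
  qed
  also have "\<dots> \<le> (\<Sum>b\<in>A. 4 * card {a \<in> A. a + b \<notin> S'})"
    by (rule sum_mono2) (use finA in auto)
  also have "\<dots> = 4 * card Bad"
    unfolding Bad_def using finA by (subst card_SigmaI) (auto simp: sum_distrib_left)
  finally have "2 * card (A - A') * n \<le> n * n" using bad unfolding power2_eq_square by linarith
  then have "2 * card (A - A') \<le> n" using n by simp
  moreover have "card A = card A' + card (A - A')"
    using finA by (subst card_Un_disjoint[symmetric]) (auto simp: A'_def intro: arg_cong[where f = card])
  ultimately show "card A \<le> 2 * card A'" unfolding n_def by linarith
  fix b c assume bc: "b \<in> A'" "c \<in> A'"
  let ?C = "{a \<in> A. a + b \<in> S' \<and> a + c \<in> S'}"
  let ?X = "{a \<in> A. a + b \<notin> S'}"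
  let ?Y = "{a \<in> A. a + c \<notin> S'}"
  have "card A \<le> card (?C \<union> (?X \<union> ?Y))" by (rule card_mono) (use finA in auto)
  also have "\<dots> \<le> card ?C + card (?X \<union> ?Y)" by (rule card_Un_le)
  also have "card (?X \<union> ?Y) \<le> card ?X + card ?Y" by (rule card_Un_le)
  finally have "card A \<le> card ?C + (card ?X + card ?Y)" by simp
  moreover have "4 * card ?X \<le> card A" "4 * card ?Y \<le> card A" using bc unfolding A'_def by auto
  ultimately show "card A \<le> 2 * card ?C" by linarith
qed

section \<open>Energy bound and the final exponent\<close>

lemma card_power30_le:
  assumes cA: "convex_finset A" and "A \<noteq> {}"
  shows "real (card A) ^ 30 \<le> 2 ^ 69 * log_loss (card A) ^ 20 * real (card (A + A)) ^ 19"
proof -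
  have finA: "finite A" using cA by (simp add: convex_finset_def)
  have finS: "finite (A + A)" using finA by (rule finite_set_plus) fact
  have neS: "A + A \<noteq> {}" using \<open>A \<noteq> {}\<close> by (auto simp: set_plus_def)
  define S' where "S' = {x \<in> A + A. (card A)\<^sup>2 \<le> 8 * card (A + A) * card {a \<in> A. x - a \<in> A}}"
  define A' where "A' = {b \<in> A. 4 * card {a \<in> A. a + b \<notin> S'} \<le> card A}"
  note struct = popular_sum_structure[OF finA \<open>A \<noteq> {}\<close>, folded S'_def, folded A'_def]
  have A'A: "A' \<subseteq> A" unfolding A'_def by auto
  have finA': "finite A'" using A'A finA by (rule finite_subset)
  define n s L where "n = real (card A)" "s = real (card (A + A))" "L = log_loss (card A)"
  note defs = n_s_L_def
  have n: "n > 0" and s: "s > 0" and L: "L \<ge> 300"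
    using finA finS neS \<open>A \<noteq> {}\<close> log_loss_ge[of "card A"] unfolding defs by (auto simp: card_gt_0_iff)
  define D where "D = (\<lambda>(a, b). a - b) ` (A' \<times> A')"
  have finD: "finite D" unfolding D_def using finA' by auto
  define E where "E = (\<Sum>d\<in>D. real (rep A' A' d) ^ 2)"
  \<comment> \<open>\<open>M ^ 9\<close> is the product of the bound for
    \<open>p ^ 7 * t ^ 12\<close> and the square of the bound \<open>L * n ^ 3\<close> for
    \<open>p * t ^ 3\<close>. The exponents fit since 7 + 2 = 9 and 12 + 6 = 18, giving
    \<open>(p * t ^ 2) ^ 9\<close>.\<close>
  define M where "M = root 9 (2 ^ 33 * L ^ 11 * s ^ 10 * n ^ 6)"
  have M9: "M ^ 9 = 2 ^ 33 * L ^ 11 * s ^ 10 * n ^ 6"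
    unfolding M_def using n s L by (intro real_root_pow_pos2) auto
  have M0: "M \<ge> 0" unfolding M_def using n s L by simp
  have level: "real (card {d \<in> D. t \<le> rep A' A' d}) * real t ^ Suc 1 \<le> M" if t: "1 \<le> t" for t
  proof -
    define p where "p = real (card {d. t \<le> rep A' A' d})"
    have finP: "finite {d. t \<le> rep A' A' d}" by (rule finite_rep_support) fact+
    have p7: "p ^ 7 * real t ^ 12 \<le> 2 ^ 33 * L ^ 9 * s ^ 10"
      unfolding p_def defs
    proof (rule popular_difference_level_le[OF cA A'A \<open>A \<noteq> {}\<close> finS _ neS _ _ t])
      show "S' \<subseteq> A + A" unfolding S'_def by auto
      show "(real (card A))\<^sup>2 \<le> 8 * real (card (A + A)) * real (card {a \<in> A. x - a \<in> A})" if "x \<in> S'" for x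
      proof -
        have "real ((card A)\<^sup>2) \<le> real (8 * card (A + A) * card {a \<in> A. x - a \<in> A})"
          using that unfolding S'_def by (simp only: of_nat_le_iff) simp
        then show ?thesis by simp
      qed
    qed (use struct in auto)
    have "rep A' A' d \<le> rep A A d" for d
      unfolding rep_def by (rule card_mono) (use finA A'A in auto)
    then have "card {d. t \<le> rep A' A' d} \<le> card {d. t \<le> rep A A d}"
      by (intro card_mono finite_rep_support finA t) (auto intro: le_trans)
    then have "card {d. t \<le> rep A' A' d} * t ^ 3 \<le> 100 * card A * card A ^ 2"
      using card_popular_differences[OF cA finA t] by (meson le_trans mult_le_mono1)
    then have "real (card {d. t \<le> rep A' A' d} * t ^ 3) \<le> real (100 * card A * card A ^ 2)"
      by (simp only: of_nat_le_iff)
    then have "p * real t ^ 3 \<le> 100 * n ^ 3" unfolding p_def defs by (simp add: power2_eq_square power3_eq_cube)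
    also have "\<dots> \<le> L * n ^ 3" using L n by (intro mult_right_mono) auto
    finally have p3: "p * real t ^ 3 \<le> L * n ^ 3" .
    have "(p * real t ^ 2) ^ 9 = (p ^ 7 * real t ^ 12) * (p * real t ^ 3)\<^sup>2" by algebra
    also have "\<dots> \<le> (2 ^ 33 * L ^ 9 * s ^ 10) * (L * n ^ 3)\<^sup>2"
    proof (rule mult_mono[OF p7])
      show "(p * real t ^ 3)\<^sup>2 \<le> (L * n ^ 3)\<^sup>2"
        using p3 by (rule power_mono) (simp add: p_def)
    qed (use L s in auto)
    also have "\<dots> = M ^ 9" unfolding M9 by algebra
    finally have "(p * real t ^ 2) ^ Suc 8 \<le> M ^ Suc 8" by simp
    then have "p * real t ^ 2 \<le> M" by (rule power_le_imp_le_base[OF _ M0])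
    moreover have "real (card {d \<in> D. t \<le> rep A' A' d}) \<le> p"
      unfolding p_def of_nat_le_iff by (rule card_mono[OF finP]) auto
    ultimately show ?thesis
      by (metis Suc_1 mult_right_mono of_nat_0_le_iff of_nat_power order_trans)
  qed
  have "E = (\<Sum>d\<in>D. real (rep A' A' d) ^ Suc 1)" unfolding E_def by (simp add: numeral_2_eq_2)
  also have "\<dots> \<le> real (Suc 1) * M * harm (card A)"
  proof (rule sum_power_le_harm[OF finD _ level])
    show "rep A' A' d \<le> card A" for d
      using rep_le_left[OF finA', of A' d] card_mono[OF finA A'A] by simp
  qed
  also have "\<dots> \<le> real (Suc 1) * M * (1 + ln (real (card A)))"
    using M0 by (intro mult_left_mono harm_le_one_plus_ln) auto
  also have "\<dots> = M * (L / 150)" unfolding defs log_loss_def by simp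
  also have "\<dots> \<le> M * L" using M0 L by (intro mult_left_mono) auto
  finally have E: "E \<le> M * L" .
  have "card A' ^ 4 \<le> card (A' + A') * (\<Sum>d\<in>D. rep A' A' d ^ 2)"
    unfolding D_def by (rule card_power4_le_energy[OF finA'])
  also have "\<dots> \<le> card (A + A) * (\<Sum>d\<in>D. rep A' A' d ^ 2)"
    by (intro mult_right_mono card_mono finS set_plus_mono2 A'A) auto
  finally have "real (card A' ^ 4) \<le> real (card (A + A) * (\<Sum>d\<in>D. rep A' A' d ^ 2))"
    by (simp only: of_nat_le_iff)
  then have E4: "real (card A') ^ 4 \<le> s * E" unfolding defs E_def by simp
  have "n \<le> 2 * real (card A')" using struct(1) unfolding defs by linarith
  then have "n ^ 4 \<le> (2 * real (card A')) ^ 4" using n by (intro power_mono) auto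
  also have "\<dots> \<le> 16 * (s * E)" using E4 by (simp add: power_mult_distrib)
  also have "\<dots> \<le> 16 * (s * (M * L))" using E s by (intro mult_left_mono) auto
  \<comment> \<open>Ninth powers remove the root in \<open>M\<close>. The constant becomes 16^9 *
    2^33 = 2^69, and \<open>n ^ 6\<close> cancels from \<open>n ^ 36\<close>.\<close>
  finally have "(n ^ 4) ^ 9 \<le> (16 * (s * (M * L))) ^ 9" using n by (intro power_mono) auto
  also have "\<dots> = 2 ^ 36 * s ^ 9 * L ^ 9 * M ^ 9" by algebra
  also have "\<dots> = n ^ 6 * (2 ^ 69 * L ^ 20 * s ^ 19)" unfolding M9 by algebra
  finally have "n ^ 6 * n ^ 30 \<le> n ^ 6 * (2 ^ 69 * L ^ 20 * s ^ 19)" by (simp add: power_mult[symmetric] power_add[symmetric])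
  then have "n ^ 30 \<le> 2 ^ 69 * L ^ 20 * s ^ 19" using n by (subst (asm) mult_le_cancel_left_pos) auto
  then show ?thesis unfolding defs .
qed

theorem theorem1p4:
  shows "\<exists>\<epsilon> :: nat \<Rightarrow> real. \<epsilon> \<longlonglongrightarrow> 0 \<and>
    (\<forall>A :: real set. convex_finset A \<longrightarrow>
       real (card (A + A)) \<ge> real (card A) powr (30 / 19 - \<epsilon> (card A)))"
proof (intro exI conjI allI impI)
  \<comment> \<open>Chosen so that \<open>n powr (19 * \<epsilon> n)\<close> equals the loss
    \<open>2 ^ 69 * log_loss n ^ 20\<close> for \<open>n > 1\<close>; its size is of order ln ln n /
    ln n.\<close>
  define \<epsilon> where "\<epsilon> n = ln (2 ^ 69 * log_loss n ^ 20) / (19 * ln (real n))" for n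
  show "\<epsilon> \<longlonglongrightarrow> 0" unfolding \<epsilon>_def log_loss_def by real_asymp
  fix A :: "real set" assume cA: "convex_finset A"
  show "real (card (A + A)) \<ge> real (card A) powr (30 / 19 - \<epsilon> (card A))"
  proof (cases "A = {}")
    case False
    define n s L where "n = real (card A)" "s = real (card (A + A))" "L = log_loss (card A)"
    note defs = n_s_L_def
    have finA: "finite A" using cA by (simp add: convex_finset_def)
    then have "finite (A + A)" by (intro finite_set_plus)
    moreover have "A + A \<noteq> {}" using False by (auto simp: set_plus_def)
    ultimately have s: "s \<ge> 1" unfolding defs by (simp add: Suc_le_eq card_gt_0_iff)
    have n: "n \<ge> 1" using False finA unfolding defs by (simp add: Suc_le_eq card_gt_0_iff)
    have L: "L > 0" using log_loss_ge[of "card A"] unfolding defs by simp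
    show ?thesis
    \<comment> \<open>For one element the denominator \<open>ln n\<close> vanishes, but the claim is
      just \<open>1 <= s\<close>.\<close>
    proof (cases "card A = 1")
      case False
      then have n1: "ln n > 0" using n unfolding defs by simp
      have "n ^ 30 \<le> (2 ^ 69 * L ^ 20) * s ^ 19"
        unfolding defs using card_power30_le[OF cA \<open>A \<noteq> {}\<close>] by simp
      then have "ln (n ^ 30) \<le> ln ((2 ^ 69 * L ^ 20) * s ^ 19)" using n s L by (subst ln_le_cancel_iff) auto
      also have "\<dots> = ln (2 ^ 69 * L ^ 20) + ln (s ^ 19)" using s L by (intro ln_mult_pos) auto
      finally have "30 * ln n \<le> ln (2 ^ 69 * L ^ 20) + 19 * ln s" using n s by (simp add: ln_realpow)
      moreover have "ln (2 ^ 69 * L ^ 20) = 19 * (\<epsilon> (card A) * ln n)"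
        using n1 unfolding \<epsilon>_def defs by simp
      ultimately have "(30 / 19 - \<epsilon> (card A)) * ln n \<le> ln s" by (simp add: algebra_simps)
      then have "exp ((30 / 19 - \<epsilon> (card A)) * ln n) \<le> s" using s by (simp add: ln_ge_iff)
      then show ?thesis using n unfolding defs powr_def by simp
    qed (use s in \<open>simp add: defs\<close>)
  qed simp
qed

end
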